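(* Let $d\ge2$ be an integer, $\alpha=-1/d$ and $p\in[0,1]$, and let $\mathcal{C}_n$ be the root cluster of $\mathcal{T}_n=\mathcal{T}_{-1/d,n}$ with broadcasting induced colouring $\sigma_n$ with parameter $p$. Then for every positive integer $k$, $$\mathbb{P}\left(\lim_{n\to\infty}|\mathcal{C}_n|=k\right)=\frac1k\binom{kd}{k-1}p^{k-1}(1-p)^{kd-k+1}.$$
   Context: The random trees $(\mathcal{T}_n)_{n\ge1}=(\mathcal{T}_{-1/d,n})_{n\ge1}$ are rooted trees grown recursively: $\mathcal{T}_1$ is a single vertex $\rho$, the root of all the trees; $\mathcal{T}_n$ is obtained from $\mathcal{T}_{n-1}$ by choosing a vertex $v$ of $\mathcal{T}_{n-1}$ at random with probability $\frac{1-\deg^+(v)/d}{\sum_{u\in V(\mathcal{T}_{n-1})}(1-\deg^+(u)/d)}$ and adding a new child to $v$, where $\deg^+(u)$ is the number of children of $u$ in $\mathcal{T}_{n-1}$. The broadcasting induced colourings $\sigma_n$ with parameter $p$ are built along with the trees: the root is red or blue with probability $1/2$ each, and every newly added vertex receives the colour of its parent with probability $p$ and the other colour with probability $1-p$, independently of everything else; colours never change. The root cluster $\mathcal{C}_n$ is the maximal monochromatic (connected) subtree of $\mathcal{T}_n$ containing the root, and $|\mathcal{C}_n|$ is its number of vertices (nondecreasing in $n$, so the limit exists in $\{1,2,\ldots\}\cup\{\infty\}$). Here $0^0=1$. *)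

theory Defs
  imports "HOL-Probability.Probability" "Graph_Theory.Digraph_Component"
begin

datatype colour = Red | Blue

text \<open>
  Trees are digraphs whose arcs point from parent to child, so that the number of children of a
  vertex is its out-degree. The vertex added in the \<open>n\<close>-th step is called \<open>n\<close>; the root is \<open>1\<close>.
\<close>

definition single_root :: "nat pair_pre_digraph" where
  "single_root = \<lparr>pverts = {1}, parcs = {}\<rparr>"

definition add_child :: "nat pair_pre_digraph \<Rightarrow> nat \<Rightarrow> nat \<Rightarrow> nat pair_pre_digraph" where
  "add_child t v w = \<lparr>pverts = insert w (pverts t), parcs = insert (v, w) (parcs t)\<rparr>"

definition attach_weight :: "nat \<Rightarrow> nat pair_pre_digraph \<Rightarrow> nat \<Rightarrow> real" where
  "attach_weight d t v = 1 - real (out_degree (with_proj t) v) / real d"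

text \<open>
  \<open>T n \<omega>\<close> and \<open>\<sigma> n \<omega>\<close> are the tree \<open>T\<^sub>n\<close> and its colouring; the colouring matters only on
  the vertices of the tree. As vertices are named by arrival and colours never change, the pair
  \<open>(T\<^sub>n, \<sigma>\<^sub>n)\<close> determines all earlier trees and colourings. Conditioning on it is therefore
  conditioning on the entire past, which is what makes the choice of the parent and the colour
  of the new vertex independent of everything that happened before. The conditional
  probabilities below are given on every past of positive probability and so fix the joint law
  of all \<open>(T\<^sub>n, \<sigma>\<^sub>n)\<close>.
\<close>

locale broadcasting_trees = prob_space M
  for M :: "'w measure" +
  fixes d :: nat and p :: real
    and T :: "nat \<Rightarrow> 'w \<Rightarrow> nat pair_pre_digraph"
    and \<sigma> :: "nat \<Rightarrow> 'w \<Rightarrow> nat \<Rightarrow> colour"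
  assumes tree_measurable:
      "\<And>n. n \<ge> 1 \<Longrightarrow> random_variable (count_space UNIV) (T n)"
    and colour_measurable:
      "\<And>n v. n \<ge> 1 \<Longrightarrow> v \<in> {1..n} \<Longrightarrow> random_variable (count_space UNIV) (\<lambda>\<omega>. \<sigma> n \<omega> v)"
    and tree_1:
      "\<And>\<omega>. \<omega> \<in> space M \<Longrightarrow> T 1 \<omega> = single_root"
    and root_colour:
      "\<And>c. \<P>(\<omega> in M. \<sigma> 1 \<omega> 1 = c) = 1/2"
    and tree_step:
      "\<And>n \<omega>. n \<ge> 1 \<Longrightarrow> \<omega> \<in> space M \<Longrightarrow>
        \<exists>v\<in>pverts (T n \<omega>). T (Suc n) \<omega> = add_child (T n \<omega>) v (Suc n)"
    and colour_kept:
      "\<And>n \<omega> v. n \<ge> 1 \<Longrightarrow> \<omega> \<in> space M \<Longrightarrow> v \<in> pverts (T n \<omega>) \<Longrightarrow> \<sigma> (Suc n) \<omega> v = \<sigma> n \<omega> v"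
    and tree_law:
      "\<And>n t s v. n \<ge> 1 \<Longrightarrow> v \<in> pverts t \<Longrightarrow>
        \<P>(\<omega> in M. T n \<omega> = t \<and> (\<forall>u\<in>pverts t. \<sigma> n \<omega> u = s u)) > 0 \<Longrightarrow>
        \<P>(\<omega> in M. T (Suc n) \<omega> = add_child t v (Suc n) \<bar>
            T n \<omega> = t \<and> (\<forall>u\<in>pverts t. \<sigma> n \<omega> u = s u))
          = attach_weight d t v / (\<Sum>u\<in>pverts t. attach_weight d t u)"
    and colour_law:
      "\<And>n t s v c. n \<ge> 1 \<Longrightarrow> v \<in> pverts t \<Longrightarrow>
        \<P>(\<omega> in M. T (Suc n) \<omega> = add_child t v (Suc n) \<and>
            T n \<omega> = t \<and> (\<forall>u\<in>pverts t. \<sigma> n \<omega> u = s u)) > 0 \<Longrightarrow>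
        \<P>(\<omega> in M. \<sigma> (Suc n) \<omega> (Suc n) = c \<bar>
            T (Suc n) \<omega> = add_child t v (Suc n) \<and>
            T n \<omega> = t \<and> (\<forall>u\<in>pverts t. \<sigma> n \<omega> u = s u))
          = (if c = s v then p else 1 - p)"

text \<open>
  Two monochromatic subtrees containing the root have a monochromatic subtree as their union, so
  there is exactly one maximal one.
\<close>

definition root_cluster ::
  "nat pair_pre_digraph \<Rightarrow> (nat \<Rightarrow> colour) \<Rightarrow> (nat, nat \<times> nat) pre_digraph" where
  "root_cluster t s = (THE H. pre_digraph.max_subgraph (with_proj t)
     (\<lambda>H. tree H \<and> 1 \<in> verts H \<and> (\<exists>c. \<forall>v\<in>verts H. s v = c)) H)"

end

theory Submission
  imports Defs
begin

text \<open>
  Give every vertex \<open>d\<close> slots for children. Each new vertex then takes one of the free slots of the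
  tree uniformly at random. Let \<open>c\<close> be the number of vertices of the root cluster and \<open>f\<close> the number
  of free slots of its vertices. A new vertex that lands in a slot of the cluster takes \<open>(c, f)\<close> to
  \<open>(c + 1, f + d - 1)\<close> with probability \<open>p\<close>, when it copies its parent's colour, and to
  \<open>(c, f - 1)\<close> otherwise; a vertex that lands elsewhere changes nothing. So, apart from waiting
  times, the pair performs a random walk from \<open>(1, d)\<close> that stops at \<open>f = 0\<close>
  (\<open>expectation_step\<close>), and the final cluster size is the total progeny of a branching process
  with binomial offspring law.

  The cycle lemma suggests a closed form \<open>hit d p k c f\<close> for the probability that the walk stops at size
  \<open>k\<close>. No paths are counted: it suffices that \<open>hit\<close> is harmonic (\<open>hit_harmonic\<close>), which is a
  binomial identity. Then the mean of \<open>hit\<close> along the process is constant and equal to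
  \<open>hit d p k 1 d\<close>, the asserted value (\<open>expectation_hit\<close>, \<open>hit_start\<close>).

  It remains to see that in the limit \<open>hit\<close> is the indicator of size \<open>k\<close>. The two agree once
  \<open>f = 0\<close> or \<open>c > k\<close>. In any other state at most \<open>life d k c f \<le> k * d\<close> steps remain
  before this happens, and vertex \<open>n + 1\<close> causes a step with probability at least \<open>1 / (n * d)\<close>. As
  the harmonic series diverges, the mean of \<open>life\<close> tends to \<open>0\<close> (\<open>expectation_life_tendsto_0\<close>). Hence the
  probability of size \<open>k\<close> at time \<open>n\<close> tends to \<open>hit d p k 1 d\<close>; since the size never
  decreases, it also tends to the probability that the limiting size is \<open>k\<close>.
\<close>

section \<open>Growing trees\<close>

text \<open>
  The possible shapes of the tree with vertices \<open>1, \<dots>, n\<close>. Facts that hold for every outcome are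
  proved for these shapes, by induction along the growth.
\<close>

inductive grown :: "nat \<Rightarrow> nat pair_pre_digraph \<Rightarrow> bool" where
  grown_root: "grown 1 single_root"
| grown_add_child: "grown n t \<Longrightarrow> v \<in> pverts t \<Longrightarrow> grown (Suc n) (add_child t v (Suc n))"

lemma pverts_add_child [simp]: "pverts (add_child t v w) = insert w (pverts t)"
  and parcs_add_child [simp]: "parcs (add_child t v w) = insert (v, w) (parcs t)"
  and pverts_single_root [simp]: "pverts single_root = {1}"
  and parcs_single_root [simp]: "parcs single_root = {}"
  by (simp_all add: add_child_def single_root_def)

lemma grown_pos: "grown n t \<Longrightarrow> n \<ge> 1"
  by (induction rule: grown.induct) auto

lemma grown_pverts: "grown n t \<Longrightarrow> pverts t = {1..n}"
  by (induction rule: grown.induct) (simp_all add: atLeastAtMostSuc_conv)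

lemma grown_parcs:
  assumes "grown n t" "(u, w) \<in> parcs t"
  shows "1 \<le> u" "u < w" "w \<le> n"
proof -
  have "1 \<le> u \<and> u < w \<and> w \<le> n"
    using assms
  proof (induction arbitrary: u w rule: grown.induct)
    case (grown_add_child n t v)
    then show ?case using grown_pverts[OF grown_add_child.hyps(1)] by force
  qed simp
  then show "1 \<le> u" "u < w" "w \<le> n" by auto
qed

lemma grown_parent_unique:
  assumes "grown n t" "(u, w) \<in> parcs t" "(u', w) \<in> parcs t"
  shows "u = u'"
  using assms
proof (induction arbitrary: u u' w rule: grown.induct)
  case (grown_add_child n t v)
  have "(x, Suc n) \<notin> parcs t" for x
    using grown_parcs(3)[OF grown_add_child.hyps(1), of x "Suc n"] by auto
  with grown_add_child show ?case by auto
qed simp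

lemma finite_parcs: "grown n t \<Longrightarrow> finite (parcs t)"
  by (induction rule: grown.induct) auto

lemma finite_grown: "finite {t. grown n t}"
proof (induction n)
  case 0
  then show ?case using grown_pos by (auto intro: finite_subset[of _ "{}"])
next
  case (Suc n)
  have "{t. grown (Suc n) t} \<subseteq>
      insert single_root ((\<lambda>(t, v). add_child t v (Suc n)) ` ({t. grown n t} \<times> {1..n}))"
    by (auto elim!: grown.cases[of "Suc n"] simp: image_iff) (metis atLeastAtMost_iff grown_pverts One_nat_def)
  then show ?case using Suc by (auto intro: finite_subset)
qed

lemma out_degree_with_proj: "out_degree (with_proj t) u = card {e \<in> parcs t. fst e = u}"
  by (simp add: out_degree_def out_arcs_def)

lemma out_degree_single_root [simp]: "out_degree (with_proj single_root) u = 0"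
  by (simp add: out_degree_with_proj)

lemma out_degree_add_child:
  assumes "grown n t"
  shows "out_degree (with_proj (add_child t v (Suc n))) u
    = out_degree (with_proj t) u + (if u = v then 1 else 0)"
proof -
  have "(v, Suc n) \<notin> parcs t"
    using grown_parcs(3)[OF assms] by fastforce
  moreover have "{e \<in> parcs (add_child t v (Suc n)). fst e = u}
    = (if u = v then insert (v, Suc n) {e \<in> parcs t. fst e = u} else {e \<in> parcs t. fst e = u})"
    by auto
  ultimately show ?thesis
    using finite_parcs[OF assms] by (auto simp: out_degree_with_proj)
qed

lemma out_degree_outside:
  assumes "grown n t" "u \<notin> pverts t"
  shows "out_degree (with_proj t) u = 0"
proof -
  have "{e \<in> parcs t. fst e = u} = {}"
    using grown_parcs[OF assms(1)] grown_pverts[OF assms(1)] assms(2) by fastforce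
  then show ?thesis by (metis card.empty out_degree_with_proj)
qed

lemma sum_out_degree: "grown n t \<Longrightarrow> (\<Sum>u\<in>pverts t. out_degree (with_proj t) u) = n - 1"
proof (induction rule: grown.induct)
  case (grown_add_child n t v)
  have fresh: "Suc n \<notin> pverts t" "v \<noteq> Suc n" and fin: "finite (pverts t)"
    using grown_pverts[OF grown_add_child.hyps(1)] grown_add_child.hyps(2) by auto
  have "(\<Sum>u\<in>pverts (add_child t v (Suc n)). out_degree (with_proj (add_child t v (Suc n))) u)
    = (\<Sum>u\<in>pverts t. out_degree (with_proj t) u + (if u = v then 1 else 0))"
    using fresh fin out_degree_outside[OF grown_add_child.hyps(1) fresh(1)]
    by (simp add: out_degree_add_child[OF grown_add_child.hyps(1)])
  also have "\<dots> = n"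
    using grown_add_child fin grown_pos[OF grown_add_child.hyps(1)]
    by (simp add: sum.distrib)
  finally show ?case by simp
qed simp

text \<open>
  A tree on \<open>n\<close> vertices has \<open>n - 1\<close> arcs, so the normalising constant of the attachment law depends
  on \<open>n\<close> only.
\<close>

lemma sum_attach_weight:
  assumes "grown n t" "d \<ge> 1"
  shows "(\<Sum>u\<in>pverts t. attach_weight d t u) = real (n * (d - 1) + 1) / d"
proof -
  have "(\<Sum>u\<in>pverts t. attach_weight d t u) = real n - real (n - 1) / d"
    using sum_out_degree[OF assms(1)] grown_pverts[OF assms(1)]
    by (simp add: attach_weight_def sum_subtractf flip: sum_divide_distrib of_nat_sum)
  also have "\<dots> = real (n * (d - 1) + 1) / d"
    using assms(2) grown_pos[OF assms(1)] by (simp add: field_simps of_nat_diff)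
  finally show ?thesis by simp
qed

section \<open>The root cluster and its free slots\<close>

text \<open>
  The vertices that are joined to the root by a path going down along vertices of the root's colour.
  Unlike the maximal subgraph, this description can be updated directly when a child is added.
\<close>

inductive_set cluster :: "nat pair_pre_digraph \<Rightarrow> (nat \<Rightarrow> colour) \<Rightarrow> nat set"
  for t s where
  root: "1 \<in> cluster t s"
| child: "u \<in> cluster t s \<Longrightarrow> (u, w) \<in> parcs t \<Longrightarrow> s w = s 1 \<Longrightarrow> w \<in> cluster t s"

lemma Suc_0_in_cluster [simp]: "Suc 0 \<in> cluster t s"
  using cluster.root by simp

lemma cluster_colour: "v \<in> cluster t s \<Longrightarrow> s v = s 1"
  by (induction rule: cluster.induct) auto

lemma cluster_subset_pverts:
  assumes "grown n t"
  shows "cluster t s \<subseteq> pverts t"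
proof
  fix v assume "v \<in> cluster t s"
  then show "v \<in> pverts t"
    by induction (use grown_parcs[OF assms] grown_pverts[OF assms] grown_pos[OF assms] in force)+
qed

lemma finite_cluster: "grown n t \<Longrightarrow> finite (cluster t s)"
  using cluster_subset_pverts grown_pverts finite_subset by (metis finite_atLeastAtMost)

lemma cluster_mono:
  assumes "v \<in> cluster t s" "parcs t \<subseteq> parcs t'" "\<And>u. u \<in> cluster t s \<Longrightarrow> s' u = s u"
  shows "v \<in> cluster t' s'"
  using assms(1)
proof induction
  case (child u w)
  then have "s' w = s w" "s' 1 = s 1" by (blast intro: assms(3) cluster.intros)+
  with child assms(2) show ?case by (auto intro: cluster.child)
qed (rule cluster.root)

lemma cluster_cong:
  assumes "grown n t" "\<And>u. u \<in> pverts t \<Longrightarrow> s' u = s u"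
  shows "cluster t s' = cluster t s"
  using cluster_mono[of _ t s t s'] cluster_mono[of _ t s' t s]
    cluster_subset_pverts[OF assms(1)] assms(2) by (smt (verit) subset_antisym subset_iff subset_refl)

lemma cluster_single_root: "cluster single_root s = {1}"
proof -
  have "v = 1" if "v \<in> cluster single_root s" for v
    using that by induction auto
  then show ?thesis by (auto intro: cluster.root)
qed

text \<open>
  A new vertex is a leaf, so it can only join the cluster itself; it opens no further path.
\<close>

lemma cluster_add_child:
  assumes "grown n t"
  shows "cluster (add_child t v (Suc n)) s
    = (if v \<in> cluster t s \<and> s (Suc n) = s 1 then insert (Suc n) (cluster t s) else cluster t s)"
    (is "?L = ?R")
proof
  have "cluster t s \<subseteq> ?L" by (auto intro: cluster_mono)
  then show "?R \<subseteq> ?L" by (auto intro: cluster.child)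
next
  show "?L \<subseteq> ?R"
  proof
    fix x assume "x \<in> ?L"
    then show "x \<in> ?R"
    proof induction
      case root
      then show ?case by (auto intro: cluster.root)
    next
      case (child u w)
      show ?case
      proof (cases "(u, w) \<in> parcs t")
        case True
        then have "u \<noteq> Suc n" using grown_parcs[OF assms True] by auto
        then have "u \<in> cluster t s" using child.IH by (auto split: if_splits)
        then show ?thesis using True child.hyps(3) by (auto intro: cluster.child)
      next
        case False
        then have "u = v" "w = Suc n" using child.hyps(2) by auto
        then show ?thesis using child.IH child.hyps(3) by (auto split: if_splits)
      qed
    qed
  qed
qed

text \<open>
  The subgraph induced on the set of vertices reached along downward monochromatic paths is a tree, as
  labels increase along arcs and every vertex is reached from the root. It contains every connected
  monochromatic subgraph \<open>H\<close> that contains the root: on a walk in \<open>H\<close> from the root, a step down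
  stays in the set by definition, and a step up leads to the unique parent, through which the path to
  the current vertex has passed. Hence it is the largest such subgraph and the only maximal one.
\<close>

lemma verts_root_cluster:
  assumes "grown n t"
  shows "verts (root_cluster t s) = cluster t s"
proof -
  define G where "G = with_proj t"
  define K where "K = cluster t s"
  define P where "P = (\<lambda>H :: (nat, nat \<times> nat) pre_digraph.
    tree H \<and> 1 \<in> verts H \<and> (\<exists>c. \<forall>v\<in>verts H. s v = c))"
  define H0 where "H0 = with_proj \<lparr>pverts = K, parcs = parcs t \<inter> K \<times> K\<rparr>"
  \<comment> \<open>\<open>H0\<close> is the candidate for the maximal subgraph.\<close>
  have wfG: "wf_digraph G"
    unfolding G_def by unfold_locales
      (use grown_parcs[OF assms] grown_pverts[OF assms] in fastforce)+
  have wfH0: "wf_digraph H0"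
    unfolding H0_def by unfold_locales auto
  have sub: "subgraph H0 G"
    by (rule subgraphI)
      (use wfG wfH0 cluster_subset_pverts[OF assms] in \<open>auto simp: G_def H0_def K_def\<close>)
  \<comment> \<open>Labels increase along walks, so there is no cycle.\<close>
  have ascending: "u < v" if "pcas u q v" "set q \<subseteq> parcs t" "q \<noteq> []" for u v q
    using that
  proof (induction q arbitrary: u)
    case (Cons e q)
    then show ?case using grown_parcs(2)[OF assms, of "fst e" "snd e"] by (cases "q = []") force+
  qed simp
  have forest: "forest H0"
    unfolding forest_def
  proof safe
    fix q assume "pre_digraph.cycle H0 q"
    then obtain u where "pcas u q u" "set q \<subseteq> parcs t" "q \<noteq> []"
      unfolding pre_digraph.cycle_def pre_digraph.awalk_def H0_def cas_with_proj_eq by auto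
    then show False using ascending by blast
  qed
  have reach: "1 \<rightarrow>\<^sup>*\<^bsub>mk_symmetric H0\<^esub> v" if "v \<in> K" for v
  proof -
    have "1 \<rightarrow>\<^sup>*\<^bsub>H0\<^esub> v"
      using that unfolding K_def
    proof induction
      case root
      show ?case
        by (rule wf_digraph.reachable_refl[OF wfH0]) (simp add: H0_def K_def)
    next
      case (child u w)
      then have "u \<rightarrow>\<^bsub>H0\<^esub> w" by (auto simp: H0_def K_def intro: cluster.child)
      with child.IH show ?case by (rule wf_digraph.reachable_adj_trans[OF wfH0])
    qed
    then show ?thesis by (rule wf_digraph.reachable_mk_symmetricI[OF wfH0])
  qed
  interpret S0: pair_wf_digraph "mk_symmetric H0"
    using wfH0 by (rule wf_digraph.wellformed_mk_symmetric)
  have conn: "connected H0"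
    unfolding connected_def
  proof (rule strongly_connectedI)
    show "verts (with_proj (mk_symmetric H0)) \<noteq> {}"
      by (auto simp: H0_def K_def intro: cluster.root)
  next
    fix u v assume "u \<in> verts (with_proj (mk_symmetric H0))"
      "v \<in> verts (with_proj (mk_symmetric H0))"
    then have "1 \<rightarrow>\<^sup>*\<^bsub>mk_symmetric H0\<^esub> u" "1 \<rightarrow>\<^sup>*\<^bsub>mk_symmetric H0\<^esub> v"
      using reach by (simp_all add: H0_def)
    then show "u \<rightarrow>\<^sup>*\<^bsub>mk_symmetric H0\<^esub> v"
      using S0.reachable_trans symmetric_reachable[OF symmetric_mk_symmetric] by metis
  qed
  have "\<exists>c. \<forall>v\<in>verts H0. s v = c"
    unfolding H0_def K_def with_proj_simps by (simp only: pair_pre_digraph.simps) (blast dest: cluster_colour)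
  then have PH0: "P H0"
    using forest conn by (simp add: P_def tree_def) (simp add: H0_def K_def)
  have largest: "subgraph H H0" if H: "subgraph H G" "P H" for H
  proof -
    have wfH: "wf_digraph H" and comp: "compatible G H" and arcsH: "arcs H \<subseteq> parcs t"
      using H(1) by (auto simp: subgraph_def G_def)
    interpret S: pair_wf_digraph "mk_symmetric H"
      using wfH by (rule wf_digraph.wellformed_mk_symmetric)
    have col: "s v = s 1" if "v \<in> verts H" for v
      using H(2) that by (auto simp: P_def)
    have "verts H \<subseteq> K"
    proof
      fix v assume "v \<in> verts H"
      then have "1 \<rightarrow>\<^sup>*\<^bsub>with_proj (mk_symmetric H)\<^esub> v"
        using H(2) by (auto simp: P_def tree_def connected_def strongly_connected_def)
      then show "v \<in> K"
      proof (induction rule: S.reachable_induct)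
        case base
        then show ?case by (auto simp: K_def intro: cluster.root)
      next
        case (step x y)
        have "y \<in> verts H" using step(2) S.in_arcsD2 by auto
        then have sy: "s y = s 1" by (rule col)
        have "(x, y) \<in> parcs t \<or> (y, x) \<in> parcs t"
          using step(2) arcsH comp
          by (auto simp: parcs_mk_symmetric compatible_def G_def with_proj_def)
        then show ?case
        proof
          assume "(x, y) \<in> parcs t"
          with step sy show ?thesis by (auto simp: K_def intro: cluster.child)
        next
          assume yx: "(y, x) \<in> parcs t"
          \<comment> \<open>The root has no parent, and any other vertex entered the set through its unique parent.\<close>
          from step(3) have "x \<in> cluster t s" by (simp add: K_def)
          then show ?thesis
          proof cases
            case root
            then show ?thesis using grown_parcs[OF assms yx] by auto
          next
            case (child u)
            then show ?thesis using grown_parent_unique[OF assms yx] by (auto simp: K_def)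
          qed
        qed
      qed
    qed
    moreover have "arcs H \<subseteq> arcs H0"
      using arcsH calculation wf_digraph.tail_in_verts[OF wfH] wf_digraph.head_in_verts[OF wfH] comp
      by (fastforce simp: H0_def compatible_def G_def)
    ultimately show ?thesis
      using wfH wfH0 comp by (intro subgraphI) (auto simp: H0_def G_def compatible_def)
  qed
  have antisym: "H = H'" if "subgraph H H'" "subgraph H' H" for H H' :: "(nat, nat \<times> nat) pre_digraph"
    using that by (auto simp: subgraph_def compatible_def)
  have "root_cluster t s = H0"
    unfolding root_cluster_def
  proof (rule the_equality)
    show "pre_digraph.max_subgraph (with_proj t)
      (\<lambda>H. tree H \<and> 1 \<in> verts H \<and> (\<exists>c. \<forall>v\<in>verts H. s v = c)) H0"
      unfolding pre_digraph.max_subgraph_def P_def[symmetric] G_def[symmetric]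
      using sub PH0 by (auto intro: antisym largest)
  next
    fix H assume "pre_digraph.max_subgraph (with_proj t)
      (\<lambda>H. tree H \<and> 1 \<in> verts H \<and> (\<exists>c. \<forall>v\<in>verts H. s v = c)) H"
    then show "H = H0"
      using largest PH0 sub unfolding pre_digraph.max_subgraph_def P_def[symmetric] G_def[symmetric]
      by metis
  qed
  then show ?thesis by (simp add: H0_def K_def)
qed

text \<open>
  The attachment weight of a vertex is proportional to the number of its child slots, out of \<open>d\<close>,
  that are still free. The natural subtraction is harmless, since trees with a vertex of more than
  \<open>d\<close> children have probability zero.
\<close>

definition free_slots :: "nat \<Rightarrow> nat pair_pre_digraph \<Rightarrow> (nat \<Rightarrow> colour) \<Rightarrow> nat" where
  "free_slots d t s = (\<Sum>u\<in>cluster t s. d - out_degree (with_proj t) u)"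

lemma free_slots_le: "free_slots d t s \<le> card (cluster t s) * d"
  unfolding free_slots_def
  using sum_bounded_above[of "cluster t s" "\<lambda>u. d - out_degree (with_proj t) u" d] by simp

lemma free_slots_cong:
  assumes "grown n t" "\<And>u. u \<in> pverts t \<Longrightarrow> s' u = s u"
  shows "free_slots d t s' = free_slots d t s"
  using cluster_cong[OF assms] by (simp add: free_slots_def)

lemma new_vertex:
  assumes "grown n t" "v \<in> pverts t"
  shows "Suc n \<notin> pverts t" "Suc n \<notin> cluster t s" "v \<noteq> Suc n"
    "out_degree (with_proj t) (Suc n) = 0"
proof -
  show *: "Suc n \<notin> pverts t" using grown_pverts[OF assms(1)] by simp
  then show "Suc n \<notin> cluster t s" "v \<noteq> Suc n" "out_degree (with_proj t) (Suc n) = 0"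
    using cluster_subset_pverts[OF assms(1)] assms(2) out_degree_outside[OF assms(1)] by auto
qed

lemma card_cluster_add_child:
  assumes "grown n t" "v \<in> pverts t"
  shows "card (cluster (add_child t v (Suc n)) s)
    = card (cluster t s) + (if v \<in> cluster t s \<and> s (Suc n) = s 1 then 1 else 0)"
  using new_vertex(2)[OF assms] finite_cluster[OF assms(1)] by (simp add: cluster_add_child[OF assms(1)])

text \<open>
  A child of a cluster vertex uses up one slot, and if it has the root's colour it brings \<open>d\<close> new ones.
\<close>

lemma free_slots_add_child:
  assumes "grown n t" "v \<in> pverts t" "out_degree (with_proj t) v < d"
  shows "free_slots d (add_child t v (Suc n)) s =
    (if v \<in> cluster t s
     then if s (Suc n) = s 1 then free_slots d t s + d - 1 else free_slots d t s - 1
     else free_slots d t s)"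
proof -
  let ?g = "\<lambda>u. d - out_degree (with_proj t) u"
  let ?t = "add_child t v (Suc n)"
  have new: "d - out_degree (with_proj ?t) (Suc n) = d"
    using new_vertex[OF assms(1,2)] by (simp add: out_degree_add_child[OF assms(1)])
  have old: "(\<Sum>u\<in>cluster t s. d - out_degree (with_proj ?t) u)
    = (if v \<in> cluster t s then free_slots d t s - 1 else free_slots d t s)"
  proof (cases "v \<in> cluster t s")
    case True
    have "(\<Sum>u\<in>cluster t s. d - out_degree (with_proj ?t) u) + 1
      = (?g v - 1) + (\<Sum>u\<in>cluster t s - {v}. ?g u) + 1"
      using True finite_cluster[OF assms(1)]
      by (simp add: sum.remove[of _ v] out_degree_add_child[OF assms(1)])
    also have "\<dots> = ?g v + (\<Sum>u\<in>cluster t s - {v}. ?g u)"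
      using assms(3) by simp
    also have "\<dots> = free_slots d t s"
      unfolding free_slots_def using True finite_cluster[OF assms(1)] by (simp add: sum.remove[of _ v])
    finally show ?thesis using True by simp
  next
    case False
    then show ?thesis
      by (auto simp: free_slots_def out_degree_add_child[OF assms(1)] intro!: sum.cong)
  qed
  have "free_slots d t s \<ge> 1" if "v \<in> cluster t s"
    unfolding free_slots_def using member_le_sum[of v "cluster t s" ?g] that
      finite_cluster[OF assms(1)] assms(3) by fastforce
  then show ?thesis
    using old new new_vertex(2)[OF assms(1,2)] finite_cluster[OF assms(1)]
    by (auto simp: free_slots_def cluster_add_child[OF assms(1)])
qed

section \<open>The stopping probability of the walk\<close>

text \<open>
  The probability that the walk started with \<open>c\<close> cluster vertices and \<open>f\<close> free slots runs out of free
  slots when the cluster has exactly \<open>k\<close> vertices. Such a path makes \<open>m = k - c\<close> steps up by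
  \<open>d - 1\<close> and \<open>N - m\<close> steps down by \<open>1\<close>, where \<open>N = f + m * d\<close>; by the cycle lemma the
  fraction \<open>f / N\<close> of the \<open>N choose m\<close> arrangements reaches \<open>0\<close> for the first time at the last step.
  At \<open>f = 0\<close> this expression reads \<open>0 / 0\<close> for \<open>c = k\<close>, so the absorbed states are listed
  separately.
\<close>

definition hit :: "nat \<Rightarrow> real \<Rightarrow> nat \<Rightarrow> nat \<Rightarrow> nat \<Rightarrow> real" where
  "hit d p k c f =
    (if c > k then 0
     else if f = 0 then of_bool (c = k)
     else let m = k - c; N = f + m * d in
       real f / real N * real (N choose m) * p ^ m * (1 - p) ^ (N - m))"

text \<open>
  A bound on the number of steps before the fate of the walk with respect to size \<open>k\<close> is decided: a
  state with \<open>c > k\<close> or \<open>f = 0\<close> is decided. Otherwise every step of the walk, up or down, decreases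
  \<open>f + (k - c) * d\<close> by exactly one, unless it decides.
\<close>

definition life :: "nat \<Rightarrow> nat \<Rightarrow> nat \<Rightarrow> nat \<Rightarrow> nat" where
  "life d k c f = (if c \<le> k \<and> f > 0 then f + (k - c) * d else 0)"

text \<open>
  Both binomial coefficients on the right are multiples of \<open>N choose m\<close>, namely by \<open>m / N\<close> and
  \<open>(N - m) / N\<close>. What remains is
  \<open>(f + d - 1) * m + (f - 1) * (N - m) = f * (N - 1)\<close>, which is \<open>N = f + m * d\<close> in disguise.
\<close>

lemma hit_coefficient:
  assumes "f \<ge> 1" "d \<ge> 1" "m \<ge> 1"
  defines "N \<equiv> f + m * d"
  shows "real f / real N * real (N choose m)
    = real (f + d - 1) / real (N - 1) * real ((N - 1) choose (m - 1))
      + real (f - 1) / real (N - 1) * real ((N - 1) choose m)"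
proof -
  have "m * 1 \<le> m * d" using assms by (intro mult_le_mono2) auto
  then have N: "N \<ge> 2" "m \<le> N" using assms(1,3) unfolding N_def by linarith+
  obtain N' m' where N': "N = Suc N'" and m': "m = Suc m'"
    using N assms(3) by (metis Suc_pred' gr0I not_numeral_le_zero not_one_le_zero)
  have up: "real N * real ((N - 1) choose (m - 1)) = real m * real (N choose m)"
    unfolding N' m' using Suc_times_binomial_eq[of N' m']
    by (metis diff_Suc_1 mult.commute of_nat_mult)
  have "(N - m) * (N choose m) = N * ((N - 1) choose m)"
    by (rule binomial_absorb_comp)
  then have down: "real N * real ((N - 1) choose m) = (real N - real m) * real (N choose m)"
    using N(2) by (metis of_nat_diff of_nat_mult)
  have "real N * (real (f + d - 1) * real ((N - 1) choose (m - 1))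
      + real (f - 1) * real ((N - 1) choose m))
    = ((real f + real d - 1) * real m + (real f - 1) * (real N - real m)) * real (N choose m)"
  proof -
    have "real (f + d - 1) = real f + real d - 1" "real (f - 1) = real f - 1"
      using assms(1) by (simp_all add: of_nat_diff)
    then have "real N * (real (f + d - 1) * real ((N - 1) choose (m - 1))
      + real (f - 1) * real ((N - 1) choose m))
      = (real f + real d - 1) * (real N * real ((N - 1) choose (m - 1)))
        + (real f - 1) * (real N * real ((N - 1) choose m))"
      by (simp only: distrib_left mult.left_commute)
    then show ?thesis unfolding up down by (simp only: distrib_right mult.assoc)
  qed
  also have "\<dots> = real f * (real N - 1) * real (N choose m)"
    by (simp add: N_def algebra_simps)
  finally have "real (f + d - 1) * real ((N - 1) choose (m - 1)) + real (f - 1) * real ((N - 1) choose m)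
    = real f * (real N - 1) * real (N choose m) / real N"
    using N by (simp add: field_simps)
  then have "(real (f + d - 1) * real ((N - 1) choose (m - 1)) + real (f - 1) * real ((N - 1) choose m)) / (real N - 1)
    = real f / real N * real (N choose m)"
    using N by simp
  then show ?thesis
    using N by (simp add: of_nat_diff add_divide_distrib)
qed

text \<open>
  Conditioning on the first step of the walk. At \<open>c = k\<close> a step up leaves the sizes up to \<open>k\<close>, and only
  \<open>f\<close> consecutive steps down reach absorption.
\<close>

lemma hit_harmonic:
  assumes "f \<ge> 1" "d \<ge> 1"
  shows "hit d p k c f = p * hit d p k (c + 1) (f + d - 1) + (1 - p) * hit d p k c (f - 1)"
proof -
  consider "c > k" | "c = k" | "c < k" by linarith
  then show ?thesis
  proof cases
    case 2
    show ?thesis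
    proof (cases "f = 1")
      case False
      then show ?thesis using 2 assms by (simp add: hit_def flip: power_Suc)
    qed (use 2 in \<open>simp add: hit_def\<close>)
  next
    case 3
    define m where "m = k - c"
    define N where "N = f + m * d"
    have m: "m \<ge> 1" "k - (c + 1) = m - 1" "c + 1 \<le> k" using 3 by (auto simp: m_def)
    have "(m - 1) * d + d = m * d" using m by (cases m) auto
    moreover have "m * 1 \<le> m * d" using assms by (intro mult_le_mono2) auto
    ultimately have N: "f + d - 1 + (m - 1) * d = N - 1" "f - 1 + m * d = N - 1"
      "f \<noteq> 1 \<Longrightarrow> m \<le> N - 1" "N - 1 - (m - 1) = N - m"
      using assms m(1) unfolding N_def by linarith+
    have "hit d p k (c + 1) (f + d - 1)
      = real (f + d - 1) / real (N - 1) * real ((N - 1) choose (m - 1)) * p ^ (m - 1) * (1 - p) ^ (N - m)"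
      using m(3) assms unfolding hit_def Let_def m(2) N(1,4) by (simp add: not_le)
    moreover have "(1 - p) * hit d p k c (f - 1)
      = real (f - 1) / real (N - 1) * real ((N - 1) choose m) * p ^ m * (1 - p) ^ (N - m)"
    proof (cases "f = 1")
      case False
      then have "N - m = Suc (N - 1 - m)" using N(3) m by auto
      then have "(1 - p) * (1 - p) ^ (N - 1 - m) = (1 - p) ^ (N - m)" by simp
      then show ?thesis
        using 3 False assms unfolding hit_def Let_def m_def[symmetric] N(2) by simp
    qed (use 3 in \<open>simp add: hit_def\<close>)
    moreover have "hit d p k c f = real f / real N * real (N choose m) * p ^ m * (1 - p) ^ (N - m)"
      using 3 assms by (simp add: hit_def m_def N_def Let_def)
    moreover have "p * (x * p ^ (m - 1) * y) + z * p ^ m * y = (x + z) * p ^ m * y" for x y z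
      using m(1) power_Suc[of p "m - 1"] by (simp add: algebra_simps)
    ultimately show ?thesis
      using hit_coefficient[OF assms m(1)] unfolding N_def[symmetric] by metis
  qed (simp add: hit_def)
qed

text \<open>
  The binomial probability in \<open>hit\<close> is one term of the expansion of \<open>(p + (1 - p)) ^ N\<close>.
\<close>

lemma hit_bounds:
  assumes "0 \<le> p" "p \<le> 1"
  shows "0 \<le> hit d p k c f" "hit d p k c f \<le> 1"
proof -
  have "real f / real N * real (N choose m) * p ^ m * (1 - p) ^ (N - m) \<in> {0..1}" if "f \<le> N" "m \<le> N" for N m
  proof -
    have "real (N choose m) * p ^ m * (1 - p) ^ (N - m) \<le> (\<Sum>m\<le>N. real (N choose m) * p ^ m * (1 - p) ^ (N - m))"
      using that assms by (intro member_le_sum) auto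
    also have "\<dots> = 1" using binomial_ring[of p "1 - p" N] by simp
    finally have "real f / real N * (real (N choose m) * p ^ m * (1 - p) ^ (N - m)) \<le> 1 * 1"
      using that assms by (intro mult_mono) (auto simp: divide_le_eq_1)
    then show ?thesis using assms by (simp add: mult.assoc)
  qed
  then have "real f / real N * real (N choose m) * p ^ m * (1 - p) ^ (N - m) \<in> {0..1}" if "f \<le> N" for N m
    using that by (cases "m \<le> N") (blast, simp add: binomial_eq_0)
  then have "real f / real (f + (k - c) * d) * real ((f + (k - c) * d) choose (k - c)) * p ^ (k - c)
      * (1 - p) ^ (f + (k - c) * d - (k - c)) \<in> {0..1}"
    by (rule meta_spec) simp
  then have "hit d p k c f \<in> {0..1}"
    unfolding hit_def Let_def by (simp only: split: if_split) auto
  then show "0 \<le> hit d p k c f" "hit d p k c f \<le> 1" by auto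
qed

text \<open>
  In a decided state \<open>hit\<close> differs from the indicator of \<open>c = k\<close> by nothing, in any other by at most
  one. Thus both have the same limit in mean once undecided states have become rare.
\<close>

lemma hit_near_indicator:
  assumes "0 \<le> p" "p \<le> 1"
  shows "\<bar>hit d p k c f - of_bool (c = k)\<bar> \<le> real (life d k c f)"
proof (cases "c \<le> k \<and> f > 0")
  case True
  then have "1 \<le> life d k c f" by (simp add: life_def)
  then have "1 \<le> real (life d k c f)" by linarith
  moreover have "\<bar>hit d p k c f - of_bool (c = k)\<bar> \<le> 1"
    using hit_bounds[OF assms, of d k c f] by (auto simp: of_bool_def abs_le_iff)
  ultimately show ?thesis by linarith
qed (auto simp: hit_def life_def)

lemma hit_start:
  assumes "k \<ge> 1" "d \<ge> 1"
  shows "hit d p k 1 d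
    = 1 / real k * real ((k * d) choose (k - 1)) * p ^ (k - 1) * (1 - p) ^ (k * d - k + 1)"
proof -
  have N: "d + (k - 1) * d = k * d" using assms by (cases k) auto
  have "k * d - (k - 1) = k * d - k + 1"
    using assms mult_le_mono2[of 1 d k] by linarith
  moreover have "real d / real (k * d) = 1 / real k" using assms by simp
  ultimately show ?thesis
    using assms unfolding hit_def Let_def N by simp
qed

lemma life_jump:
  assumes "f \<ge> 1" "d \<ge> 1"
  shows "life d k (c + 1) (f + d - 1) \<le> life d k c f - 1" "life d k c (f - 1) \<le> life d k c f - 1"
proof -
  have "f + d - 1 + (k - (c + 1)) * d = f + (k - c) * d - 1" if "c + 1 \<le> k"
  proof -
    have "k - c = Suc (k - (c + 1))" using that by simp
    then show ?thesis using assms by simp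
  qed
  then show "life d k (c + 1) (f + d - 1) \<le> life d k c f - 1"
    using assms by (auto simp: life_def)
  show "life d k c (f - 1) \<le> life d k c f - 1"
    using assms by (auto simp: life_def)
qed

lemma life_le:
  assumes "f \<le> c * d"
  shows "life d k c f \<le> k * d"
proof -
  have "f + (k - c) * d \<le> k * d" if "c \<le> k"
    using assms that by (metis add_le_mono1 add_mult_distrib le_add_diff_inverse)
  then show ?thesis by (simp add: life_def)
qed

text \<open>
  The mean of \<open>F\<close> after the arrival of vertex \<open>n + 1\<close>, given cluster size \<open>c\<close> and \<open>f\<close> free slots. The
  tree on \<open>n\<close> vertices has \<open>n * d - (n - 1) = n * (d - 1) + 1\<close> free slots, and the new vertex takes a
  uniformly chosen one; the walk makes a step when this slot belongs to the cluster.
\<close>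

definition mean_after_step ::
  "nat \<Rightarrow> real \<Rightarrow> nat \<Rightarrow> (nat \<Rightarrow> nat \<Rightarrow> real) \<Rightarrow> nat \<Rightarrow> nat \<Rightarrow> real" where
  "mean_after_step d p n F c f = F c f + real f / real (n * (d - 1) + 1)
    * (p * F (c + 1) (f + d - 1) + (1 - p) * F c (f - 1) - F c f)"

lemma mean_hit:
  assumes "d \<ge> 1"
  shows "mean_after_step d p n (hit d p k) = hit d p k"
proof (intro ext)
  fix c f
  show "mean_after_step d p n (hit d p k) c f = hit d p k c f"
    using hit_harmonic[OF _ assms, of f p k c] by (cases "f = 0") (auto simp: mean_after_step_def)
qed

text \<open>
  While undecided the walk moves with probability at least \<open>1 / (n * d)\<close>, and a move costs one unit of
  \<open>life\<close>, which is at least the fraction \<open>1 / (k * d)\<close> of all that is left.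
\<close>

lemma mean_life:
  assumes "d \<ge> 1" "0 \<le> p" "p \<le> 1" "n \<ge> 1" "k \<ge> 1" "f \<le> c * d"
  shows "mean_after_step d p n (\<lambda>c f. real (life d k c f)) c f
    \<le> (1 - 1 / real (k * d * d) / real n) * real (life d k c f)"
proof (cases "life d k c f = 0")
  case True
  have "f = 0 \<or> c > k" using True by (auto simp: life_def split: if_splits)
  then show ?thesis by (auto simp: mean_after_step_def life_def)
next
  case False
  then have f: "f \<ge> 1" by (auto simp: life_def split: if_splits)
  define D where "D = real (n * (d - 1) + 1)"
  define L where "L = real (life d k c f)"
  have L: "1 \<le> L" "L \<le> real (k * d)"
    using False life_le[OF assms(6), of k] by (auto simp: L_def simp flip: of_nat_mult)
  have jump: "real (life d k (c + 1) (f + d - 1)) \<le> L - 1" "real (life d k c (f - 1)) \<le> L - 1"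
    using life_jump[OF f assms(1), of k c] False by (auto simp: L_def)
  have "n * (d - 1) + 1 \<le> n * d"
    using assms(1,4) by (cases d) auto
  then have D: "0 < D" "D \<le> real (n * d)"
    unfolding D_def by (auto simp del: of_nat_add of_nat_mult)
  have "p * real (life d k (c + 1) (f + d - 1)) + (1 - p) * real (life d k c (f - 1))
    \<le> p * (L - 1) + (1 - p) * (L - 1)"
    using jump assms by (intro add_mono mult_left_mono) auto
  then have drop: "p * real (life d k (c + 1) (f + d - 1)) + (1 - p) * real (life d k c (f - 1)) - L \<le> - 1"
    by (simp add: algebra_simps)
  have "mean_after_step d p n (\<lambda>c f. real (life d k c f)) c f \<le> L + real f / D * (- 1)"
    unfolding mean_after_step_def D_def[symmetric] L_def[symmetric]
    using drop D by (intro add_left_mono mult_left_mono) auto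
  also have "\<dots> \<le> L - 1 / D"
    using f D by (simp add: divide_right_mono)
  also have "1 / D \<ge> 1 / real (n * d)"
    using D by (simp add: frac_le)
  then have "L - 1 / D \<le> L - 1 / real (n * d)" by simp
  also have "1 / real (n * d) \<ge> (L / real (k * d)) / real (n * d)"
    using L assms by (intro divide_right_mono) auto
  then have "L - 1 / real (n * d) \<le> (1 - 1 / real (k * d * d) / real n) * L"
    by (simp add: algebra_simps)
  finally show ?thesis unfolding L_def .
qed

text \<open>
  The product of the factors \<open>1 - K / i\<close> over \<open>i \<le> n\<close> is at most \<open>exp (- K * harm n)\<close>, and the harmonic
  series diverges.
\<close>

lemma tendsto_zero_of_harmonic_contraction:
  fixes e :: "nat \<Rightarrow> real"
  assumes "K > 0" "\<And>n. 0 \<le> e n" "\<And>n. n \<ge> 1 \<Longrightarrow> e (Suc n) \<le> (1 - K / real n) * e n"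
  shows "e \<longlonglongrightarrow> 0"
proof -
  have bound: "e (Suc n) \<le> exp (- K * harm n) * e 1" for n
  proof (induction n)
    case (Suc n)
    have "e (Suc (Suc n)) \<le> (1 - K / real (Suc n)) * e (Suc n)" by (intro assms) simp
    also have "\<dots> \<le> exp (- K / real (Suc n)) * e (Suc n)"
      using exp_ge_add_one_self[of "- K / real (Suc n)"] assms(2)[of "Suc n"]
      by (intro mult_right_mono) auto
    also have "\<dots> \<le> exp (- K / real (Suc n)) * (exp (- K * harm n) * e 1)"
      using Suc by (intro mult_left_mono) auto
    also have "\<dots> = exp (- K / real (Suc n) + - K * harm n) * e 1"
      by (simp only: exp_add mult.assoc)
    also have "- K / real (Suc n) + - K * harm n = - K * harm (Suc n)"
      by (simp add: harm_Suc divide_inverse algebra_simps)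
    finally show ?case .
  qed (simp add: harm_def)
  have "filterlim (\<lambda>n. K * harm n) at_top sequentially"
    using assms(1) by (intro filterlim_tendsto_pos_mult_at_top[OF tendsto_const] harm_at_top)
  then have "(\<lambda>n. exp (- K * harm n)) \<longlonglongrightarrow> 0"
    by (auto intro!: filterlim_compose[OF exp_at_bot] simp: filterlim_uminus_at_top)
  then have "(\<lambda>n. exp (- K * harm n) * e 1) \<longlonglongrightarrow> 0"
    by (rule tendsto_mult_left_zero)
  then have "(\<lambda>n. e (Suc n)) \<longlonglongrightarrow> 0"
    by (rule tendsto_sandwich[OF always_eventually always_eventually tendsto_const, rotated 2])
      (use bound assms(2) in blast)+
  then show ?thesis by (simp only: filterlim_sequentially_Suc)
qed

section \<open>The law of one growth step\<close>

lemma UNIV_colour: "UNIV = {Red, Blue}"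
  using colour.exhaust by auto

lemma finite_UNIV_colour [simp]: "finite (UNIV :: colour set)"
  by (simp add: UNIV_colour)

lemma sum_colour:
  fixes x y :: real and a :: colour
  shows "(\<Sum>c\<in>UNIV. (if c = a then p else 1 - p) * (if c = a then x else y)) = p * x + (1 - p) * y"
  by (cases a) (simp_all add: UNIV_colour)

lemma (in prob_space) expectation_finite_partition:
  fixes x :: "'i \<Rightarrow> real"
  assumes "finite I" "\<And>i. i \<in> I \<Longrightarrow> A i \<in> events" "\<And>\<omega>. \<omega> \<in> space M \<Longrightarrow> \<exists>!i. i \<in> I \<and> \<omega> \<in> A i"
    and "\<And>i \<omega>. i \<in> I \<Longrightarrow> \<omega> \<in> A i \<Longrightarrow> X \<omega> = x i"
  shows "integrable M X" "expectation X = (\<Sum>i\<in>I. prob (A i) * x i)"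
proof -
  have X: "X \<omega> = (\<Sum>i\<in>I. x i * indicator (A i) \<omega>)" if \<omega>: "\<omega> \<in> space M" for \<omega>
  proof -
    obtain i where i: "i \<in> I" "\<omega> \<in> A i" and uniq: "\<And>j. j \<in> I \<Longrightarrow> \<omega> \<in> A j \<Longrightarrow> j = i"
      using assms(3)[OF \<omega>] by blast
    have "(\<Sum>j\<in>I. x j * indicator (A j) \<omega>) = (\<Sum>j\<in>I. if j = i then x i else 0)"
    proof (intro sum.cong refl)
      fix j assume "j \<in> I"
      then have "\<omega> \<in> A j \<longleftrightarrow> j = i" using i(2) uniq by blast
      then show "x j * indicator (A j) \<omega> = (if j = i then x i else 0)"
        unfolding indicator_def by simp
    qed
    also have "\<dots> = X \<omega>" using i(1) assms(1) assms(4)[OF i] by (simp only: sum.delta if_True)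
    finally show ?thesis by (rule sym)
  qed
  have int: "integrable M (\<lambda>\<omega>. x i * indicator (A i) \<omega>)" if "i \<in> I" for i
    using assms(2)[OF that] by (intro integrable_mult_right integrable_real_indicator) (auto simp: emeasure_eq_measure)
  show "integrable M X"
    by (subst Bochner_Integration.integrable_cong[OF refl X]) (auto intro: int)
  have "expectation X = expectation (\<lambda>\<omega>. \<Sum>i\<in>I. x i * indicator (A i) \<omega>)"
    by (intro Bochner_Integration.integral_cong X refl)
  also have "\<dots> = (\<Sum>i\<in>I. x i * prob (A i))"
    using int assms(2) by (subst Bochner_Integration.integral_sum) (auto intro!: sum.cong)
  finally show "expectation X = (\<Sum>i\<in>I. prob (A i) * x i)"
    by (simp add: mult.commute)
qed

context broadcasting_trees
begin

lemma grown_T: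
  assumes "n \<ge> 1" "\<omega> \<in> space M"
  shows "grown n (T n \<omega>)"
  using assms(1)
proof (induction n rule: dec_induct)
  case base
  then show ?case using tree_1[OF assms(2)] grown_root by simp
next
  case (step n)
  then show ?case using tree_step[OF step.hyps(1) assms(2)] grown_add_child by metis
qed

definition past :: "nat \<Rightarrow> nat pair_pre_digraph \<Rightarrow> (nat \<Rightarrow> colour) \<Rightarrow> 'w set" where
  "past n t s = {\<omega> \<in> space M. T n \<omega> = t \<and> (\<forall>u\<in>pverts t. \<sigma> n \<omega> u = s u)}"

definition past_and_child ::
    "nat \<Rightarrow> nat pair_pre_digraph \<Rightarrow> (nat \<Rightarrow> colour) \<Rightarrow> nat \<Rightarrow> colour \<Rightarrow> 'w set" where
  "past_and_child n t s v c =
    {\<omega> \<in> past n t s. T (Suc n) \<omega> = add_child t v (Suc n) \<and> \<sigma> (Suc n) \<omega> (Suc n) = c}"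

text \<open>
  Colourings are made extensional on \<open>{1..n}\<close>, so that each outcome has exactly one past.
\<close>

definition pasts :: "nat \<Rightarrow> (nat pair_pre_digraph \<times> (nat \<Rightarrow> colour)) set" where
  "pasts n = {t. grown n t} \<times> ({1..n} \<rightarrow>\<^sub>E UNIV)"

lemma finite_pasts: "finite (pasts n)"
  unfolding pasts_def by (intro finite_cartesian_product finite_grown finite_PiE) auto

lemma tree_event: "n \<ge> 1 \<Longrightarrow> {\<omega> \<in> space M. T n \<omega> = t} \<in> events"
  using measurable_sets[OF tree_measurable, of n "{t}"] by (simp add: vimage_def Int_def conj_commute)

lemma colour_event: "1 \<le> v \<Longrightarrow> v \<le> n \<Longrightarrow> {\<omega> \<in> space M. \<sigma> n \<omega> v = c} \<in> events"
  using measurable_sets[OF colour_measurable, of n v "{c}"] by (simp add: vimage_def Int_def conj_commute)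

lemma past_event:
  assumes "grown n t"
  shows "past n t s \<in> events"
proof -
  have "past n t s = {\<omega> \<in> space M. T n \<omega> = t} \<inter> {\<omega> \<in> space M. \<forall>u\<in>{1..n}. \<sigma> n \<omega> u = s u}"
    using grown_pverts[OF assms] by (auto simp: past_def)
  also have "\<dots> \<in> events"
    by (intro sets.Int tree_event grown_pos[OF assms] sets.sets_Collect_finite_All colour_event) auto
  finally show ?thesis .
qed

lemma past_and_child_event:
  assumes "grown n t"
  shows "past_and_child n t s v c \<in> events"
proof -
  have "past_and_child n t s v c = past n t s \<inter> ({\<omega> \<in> space M. T (Suc n) \<omega> = add_child t v (Suc n)}
      \<inter> {\<omega> \<in> space M. \<sigma> (Suc n) \<omega> (Suc n) = c})"
    by (auto simp: past_and_child_def past_def)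
  also have "\<dots> \<in> events"
    by (intro sets.Int past_event assms tree_event colour_event) auto
  finally show ?thesis .
qed

lemma unique_past:
  assumes "n \<ge> 1" "\<omega> \<in> space M"
  shows "\<exists>!x. x \<in> pasts n \<and> \<omega> \<in> past n (fst x) (snd x)"
proof (rule ex1I[of _ "(T n \<omega>, restrict (\<sigma> n \<omega>) {1..n})"])
  show "(T n \<omega>, restrict (\<sigma> n \<omega>) {1..n}) \<in> pasts n \<and>
      \<omega> \<in> past n (fst (T n \<omega>, restrict (\<sigma> n \<omega>) {1..n})) (snd (T n \<omega>, restrict (\<sigma> n \<omega>) {1..n}))"
    using assms grown_T[OF assms] grown_pverts[OF grown_T[OF assms]] by (auto simp: pasts_def past_def)
next
  fix x assume x: "x \<in> pasts n \<and> \<omega> \<in> past n (fst x) (snd x)"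
  then have "fst x = T n \<omega>" by (auto simp: past_def)
  moreover have "snd x = restrict (\<sigma> n \<omega>) {1..n}"
    using x grown_pverts[OF grown_T[OF assms]]
    by (intro extensionalityI[of _ "{1..n}"]) (auto simp: past_def pasts_def PiE_def)
  ultimately show "x = (T n \<omega>, restrict (\<sigma> n \<omega>) {1..n})" by (simp add: prod_eq_iff)
qed

lemma
  fixes \<Phi> :: "nat pair_pre_digraph \<Rightarrow> (nat \<Rightarrow> colour) \<Rightarrow> real"
  assumes "n \<ge> 1"
    and cong: "\<And>t s s'. grown n t \<Longrightarrow> (\<And>u. u \<in> pverts t \<Longrightarrow> s' u = s u) \<Longrightarrow> \<Phi> t s' = \<Phi> t s"
  shows integrable_past: "integrable M (\<lambda>\<omega>. \<Phi> (T n \<omega>) (\<sigma> n \<omega>))"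
    and expectation_past:
      "expectation (\<lambda>\<omega>. \<Phi> (T n \<omega>) (\<sigma> n \<omega>)) = (\<Sum>(t, s)\<in>pasts n. prob (past n t s) * \<Phi> t s)"
proof -
  have ev: "past n (fst x) (snd x) \<in> events" if "x \<in> pasts n" for x
    using that by (auto simp: pasts_def intro: past_event)
  have val: "\<Phi> (T n \<omega>) (\<sigma> n \<omega>) = \<Phi> (fst x) (snd x)" if "x \<in> pasts n" "\<omega> \<in> past n (fst x) (snd x)" for x \<omega>
    using that by (auto simp: pasts_def past_def intro!: cong)
  show "integrable M (\<lambda>\<omega>. \<Phi> (T n \<omega>) (\<sigma> n \<omega>))"
    by (rule expectation_finite_partition(1)[OF finite_pasts ev unique_past[OF assms(1)] val])
  show "expectation (\<lambda>\<omega>. \<Phi> (T n \<omega>) (\<sigma> n \<omega>)) = (\<Sum>(t, s)\<in>pasts n. prob (past n t s) * \<Phi> t s)"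
    unfolding case_prod_unfold
    by (rule expectation_finite_partition(2)[OF finite_pasts ev unique_past[OF assms(1)] val])
qed

text \<open>
  The past at time \<open>n\<close>, the parent and the colour of the new vertex determine the coloured tree at time
  \<open>n + 1\<close>, and they split the probability space into finitely many events.
\<close>

lemma expectation_past_and_child:
  fixes \<Phi> :: "nat pair_pre_digraph \<Rightarrow> (nat \<Rightarrow> colour) \<Rightarrow> real"
  assumes "n \<ge> 1"
    and cong: "\<And>t s s'. grown (Suc n) t \<Longrightarrow> (\<And>u. u \<in> pverts t \<Longrightarrow> s' u = s u) \<Longrightarrow> \<Phi> t s' = \<Phi> t s"
  shows "expectation (\<lambda>\<omega>. \<Phi> (T (Suc n) \<omega>) (\<sigma> (Suc n) \<omega>))
    = (\<Sum>(t, s)\<in>pasts n. \<Sum>v\<in>pverts t. \<Sum>c\<in>UNIV.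
        prob (past_and_child n t s v c) * \<Phi> (add_child t v (Suc n)) (s(Suc n := c)))"
proof -
  define I where "I = pasts n \<times> {1..n} \<times> (UNIV :: colour set)"
  define A where "A = (\<lambda>((t, s), v, c). past_and_child n t s v c)"
  define x where "x = (\<lambda>((t, s), v, c). \<Phi> (add_child t v (Suc n)) (s(Suc n := c)))"
  have fin: "finite I" unfolding I_def by (intro finite_cartesian_product finite_pasts) auto
  have ev: "A i \<in> events" if "i \<in> I" for i
    using that by (auto simp: I_def A_def pasts_def intro: past_and_child_event)
  have uniq: "\<exists>!i. i \<in> I \<and> \<omega> \<in> A i" if \<omega>: "\<omega> \<in> space M" for \<omega>
  proof -
    obtain t s where ts: "(t, s) \<in> pasts n" "\<omega> \<in> past n t s"
      and ts_uniq: "\<And>y. y \<in> pasts n \<Longrightarrow> \<omega> \<in> past n (fst y) (snd y) \<Longrightarrow> y = (t, s)"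
      using unique_past[OF assms(1) \<omega>] by (metis prod.collapse)
    have t: "T n \<omega> = t" "grown n t" using ts by (auto simp: past_def pasts_def)
    obtain v where v: "v \<in> pverts t" "T (Suc n) \<omega> = add_child t v (Suc n)"
      using tree_step[OF assms(1) \<omega>] t by auto
    have arc: "(v', Suc n) \<notin> parcs t" for v'
      using grown_parcs(3)[OF t(2), of v' "Suc n"] by auto
    show ?thesis
    proof (rule ex1I[of _ "((t, s), v, \<sigma> (Suc n) \<omega> (Suc n))"])
      show "((t, s), v, \<sigma> (Suc n) \<omega> (Suc n)) \<in> I \<and> \<omega> \<in> A ((t, s), v, \<sigma> (Suc n) \<omega> (Suc n))"
        using ts v grown_pverts[OF t(2)] by (auto simp: I_def A_def past_and_child_def)
    next
      fix i assume i: "i \<in> I \<and> \<omega> \<in> A i"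
      obtain t' s' v' c' where i_eq: "i = ((t', s'), v', c')" by (metis prod.collapse)
      have ts': "t' = t" "s' = s"
        using i ts_uniq[of "(t', s')"] by (auto simp: i_eq I_def A_def past_and_child_def)
      moreover have "c' = \<sigma> (Suc n) \<omega> (Suc n)"
        using i by (auto simp: i_eq A_def past_and_child_def)
      moreover have "add_child t v' (Suc n) = add_child t v (Suc n)"
        using i v(2) ts' by (auto simp: i_eq A_def past_and_child_def)
      then have "parcs (add_child t v' (Suc n)) = parcs (add_child t v (Suc n))" by simp
      then have "v' = v" using arc by auto
      ultimately show "i = ((t, s), v, \<sigma> (Suc n) \<omega> (Suc n))" by (simp add: i_eq)
    qed
  qed
  have val: "\<Phi> (T (Suc n) \<omega>) (\<sigma> (Suc n) \<omega>) = x i" if i: "i \<in> I" "\<omega> \<in> A i" for i \<omega>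
  proof -
    obtain t s v c where i_eq: "i = ((t, s), v, c)" by (metis prod.collapse)
    have t: "grown n t" "v \<in> pverts t"
      using i by (auto simp: i_eq I_def pasts_def grown_pverts)
    have \<omega>: "\<omega> \<in> space M" "T n \<omega> = t" "\<And>u. u \<in> pverts t \<Longrightarrow> \<sigma> n \<omega> u = s u"
      "T (Suc n) \<omega> = add_child t v (Suc n)" "\<sigma> (Suc n) \<omega> (Suc n) = c"
      using i by (auto simp: i_eq A_def past_and_child_def past_def)
    have "\<sigma> (Suc n) \<omega> u = (s(Suc n := c)) u" if "u \<in> pverts (add_child t v (Suc n))" for u
      using that \<omega> colour_kept[OF assms(1) \<omega>(1)] new_vertex(1)[OF t] by auto
    then show ?thesis
      unfolding \<omega>(4) i_eq x_def using grown_add_child[OF t] by (auto intro!: cong)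
  qed
  have "expectation (\<lambda>\<omega>. \<Phi> (T (Suc n) \<omega>) (\<sigma> (Suc n) \<omega>)) = (\<Sum>i\<in>I. prob (A i) * x i)"
    by (rule expectation_finite_partition(2)[OF fin ev uniq val])
  also have "\<dots> = (\<Sum>y\<in>pasts n. \<Sum>v\<in>{1..n}. \<Sum>c\<in>UNIV. prob (A (y, v, c)) * x (y, v, c))"
    unfolding I_def by (simp add: sum.cartesian_product)
  also have "\<dots> = (\<Sum>(t, s)\<in>pasts n. \<Sum>v\<in>pverts t. \<Sum>c\<in>UNIV.
        prob (past_and_child n t s v c) * \<Phi> (add_child t v (Suc n)) (s(Suc n := c)))"
    by (intro sum.cong refl) (auto simp: A_def x_def pasts_def grown_pverts)
  finally show ?thesis .
qed

text \<open>
  The product of the two conditional laws. When the choice of the parent \<open>v\<close> has probability zero, the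
  colour law says nothing, but then both sides vanish.
\<close>

lemma prob_past_and_child:
  assumes "grown n t" "v \<in> pverts t" "prob (past n t s) > 0"
  shows "prob (past_and_child n t s v c) = prob (past n t s)
    * (attach_weight d t v / (\<Sum>u\<in>pverts t. attach_weight d t u)) * (if c = s v then p else 1 - p)"
proof -
  define E where "E = {\<omega> \<in> space M. T (Suc n) \<omega> = add_child t v (Suc n) \<and>
    T n \<omega> = t \<and> (\<forall>u\<in>pverts t. \<sigma> n \<omega> u = s u)}"
  have n: "n \<ge> 1" by (rule grown_pos[OF assms(1)])
  have "prob E / prob (past n t s) = attach_weight d t v / (\<Sum>u\<in>pverts t. attach_weight d t u)"
    using tree_law[OF n assms(2), of s] assms(3) unfolding cond_prob_def past_def E_def by simp
  then have E: "prob E = prob (past n t s) * (attach_weight d t v / (\<Sum>u\<in>pverts t. attach_weight d t u))"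
    using assms(3) by (simp add: field_simps)
  have child: "past_and_child n t s v c = {\<omega> \<in> space M. \<sigma> (Suc n) \<omega> (Suc n) = c \<and>
      T (Suc n) \<omega> = add_child t v (Suc n) \<and> T n \<omega> = t \<and> (\<forall>u\<in>pverts t. \<sigma> n \<omega> u = s u)}"
    by (auto simp: past_and_child_def past_def)
  have "prob (past_and_child n t s v c) = prob E * (if c = s v then p else 1 - p)"
  proof (cases "prob E > 0")
    case True
    then show ?thesis
      using colour_law[OF n assms(2), of s c] unfolding cond_prob_def child E_def
      by (simp add: field_simps)
  next
    case False
    have "E = past n t s \<inter> {\<omega> \<in> space M. T (Suc n) \<omega> = add_child t v (Suc n)}"
      by (auto simp: E_def past_def)
    then have "E \<in> events" using past_event[OF assms(1)] tree_event by auto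
    then have "prob (past_and_child n t s v c) \<le> prob E"
      by (intro finite_measure_mono) (auto simp: child E_def)
    with False have "prob E = 0" "prob (past_and_child n t s v c) = 0"
      using measure_nonneg[of M E] measure_nonneg[of M "past_and_child n t s v c"] by linarith+
    then show ?thesis by simp
  qed
  then show ?thesis by (simp add: E)
qed

text \<open>
  A full vertex receives no further child, so it never gets overfull; formally, weights in a past of
  positive probability are proportional to probabilities and hence nonnegative.
\<close>

lemma out_degree_le:
  assumes "d \<ge> 1" "grown n t" "v \<in> pverts t" "prob (past n t s) > 0"
  shows "out_degree (with_proj t) v \<le> d"
proof -
  have "0 \<le> attach_weight d t v / (\<Sum>u\<in>pverts t. attach_weight d t u)"
    using tree_law[OF grown_pos[OF assms(2)] assms(3), of s] assms(4)
    unfolding past_def cond_prob_def by (metis (no_types, lifting) measure_nonneg zero_le_divide_iff)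
  moreover have "(\<Sum>u\<in>pverts t. attach_weight d t u) > 0"
    using assms(1) by (simp add: sum_attach_weight[OF assms(2)] del: of_nat_add of_nat_mult)
  ultimately have "0 \<le> attach_weight d t v" by (simp add: zero_le_divide_iff)
  then show ?thesis using assms(1) by (simp add: attach_weight_def)
qed

abbreviation size_at :: "nat \<Rightarrow> 'w \<Rightarrow> nat" where
  "size_at n \<omega> \<equiv> card (cluster (T n \<omega>) (\<sigma> n \<omega>))"

abbreviation slots_at :: "nat \<Rightarrow> 'w \<Rightarrow> nat" where
  "slots_at n \<omega> \<equiv> free_slots d (T n \<omega>) (\<sigma> n \<omega>)"

text \<open>
  The Markov property of cluster size and free slots. Within one past, the slots of the vertices
  outside the cluster contribute the unchanged state and those of the cluster vertices a step of the
  walk, up with probability \<open>p\<close> and down with probability \<open>1 - p\<close>.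
\<close>

lemma expectation_step:
  fixes F :: "nat \<Rightarrow> nat \<Rightarrow> real"
  assumes "n \<ge> 1" "d \<ge> 1"
  shows "expectation (\<lambda>\<omega>. F (size_at (Suc n) \<omega>) (slots_at (Suc n) \<omega>))
    = expectation (\<lambda>\<omega>. mean_after_step d p n F (size_at n \<omega>) (slots_at n \<omega>))"
proof -
  define \<Phi> where "\<Phi> = (\<lambda>t s. F (card (cluster t s)) (free_slots d t s))"
  define \<Psi> where "\<Psi> = (\<lambda>t s. mean_after_step d p n F (card (cluster t s)) (free_slots d t s))"
  have step: "(\<Sum>v\<in>pverts t. \<Sum>c\<in>UNIV.
      prob (past_and_child n t s v c) * \<Phi> (add_child t v (Suc n)) (s(Suc n := c)))
    = prob (past n t s) * \<Psi> t s" if t: "grown n t" for t s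
  proof (cases "prob (past n t s) > 0")
    case False
    then have "prob (past n t s) = 0" using measure_nonneg[of M "past n t s"] by linarith
    moreover have "prob (past_and_child n t s v c) \<le> prob (past n t s)" for v c
      by (intro finite_measure_mono past_event t) (auto simp: past_and_child_def)
    ultimately show ?thesis by (simp add: measure_le_0_iff)
  next
    case pos: True
    define K where "K = cluster t s"
    define f where "f = free_slots d t s"
    define D where "D = real (n * (d - 1) + 1)"
    define g where "g = (\<lambda>v. real (d - out_degree (with_proj t) v))"
    define m where "m = p * F (card K + 1) (f + d - 1) + (1 - p) * F (card K) (f - 1)"
    have D: "D > 0" by (simp add: D_def del: of_nat_add of_nat_mult)
    have w: "attach_weight d t v = g v / d" if "v \<in> pverts t" for v
      using out_degree_le[OF assms(2) t that pos] assms(2)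
      by (simp add: attach_weight_def g_def of_nat_diff diff_divide_distrib)
    have W: "(\<Sum>u\<in>pverts t. attach_weight d t u) = D / d"
      unfolding D_def by (rule sum_attach_weight[OF t assms(2)])
    have gD: "(\<Sum>v\<in>pverts t. g v) = D"
      using W w assms(2) by (simp flip: sum_divide_distrib)
    have K: "K \<subseteq> pverts t" "finite (pverts t)" "finite K"
      using cluster_subset_pverts[OF t] grown_pverts[OF t] finite_cluster[OF t] by (auto simp: K_def)
    have gK: "(\<Sum>v\<in>K. g v) = f" by (simp add: g_def f_def free_slots_def K_def)
    have inner: "(\<Sum>c\<in>UNIV. prob (past_and_child n t s v c) * \<Phi> (add_child t v (Suc n)) (s(Suc n := c)))
      = prob (past n t s) / D * (g v * (if v \<in> K then m else F (card K) f))"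
      if v: "v \<in> pverts t" for v
    proof -
      have q: "prob (past_and_child n t s v c)
          = prob (past n t s) * (g v / D) * (if c = s v then p else 1 - p)" for c
        using prob_past_and_child[OF t v pos] assms(2) unfolding W by (simp add: w[OF v])
      have val: "\<Phi> (add_child t v (Suc n)) (s(Suc n := c))
          = (if v \<in> K then if c = s v then F (card K + 1) (f + d - 1) else F (card K) (f - 1)
             else F (card K) f)"
        if less: "out_degree (with_proj t) v < d" for c
      proof -
        have same: "cluster t (s(Suc n := c)) = K" "free_slots d t (s(Suc n := c)) = f"
          using new_vertex(1)[OF t v] unfolding K_def f_def
          by (auto intro!: cluster_cong[OF t] free_slots_cong[OF t])
        have "s v = s 1" if "v \<in> K" using that unfolding K_def by (rule cluster_colour)
        then show ?thesis
          using grown_pos[OF t]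
          unfolding \<Phi>_def card_cluster_add_child[OF t v] free_slots_add_child[OF t v less] same
          by auto
      qed
      show ?thesis
      proof (cases "out_degree (with_proj t) v < d")
        \<comment> \<open>A full vertex has weight zero, so the state after giving it a child does not matter.\<close>
        case False
        then have "g v = 0" by (simp add: g_def)
        then show ?thesis by (simp add: q)
      next
        case True
        have "(\<Sum>c\<in>UNIV. prob (past_and_child n t s v c) * \<Phi> (add_child t v (Suc n)) (s(Suc n := c)))
          = prob (past n t s) / D * g v * (\<Sum>c\<in>UNIV. (if c = s v then p else 1 - p) *
              (if c = s v then if v \<in> K then F (card K + 1) (f + d - 1) else F (card K) f
               else if v \<in> K then F (card K) (f - 1) else F (card K) f))"
          unfolding q val[OF True] sum_distrib_left by (intro sum.cong) auto
        also have "\<dots> = prob (past n t s) / D * (g v * (if v \<in> K then m else F (card K) f))"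
        proof (cases "v \<in> K")
          case False
          have "p * x + (1 - p) * x = x" for x by (simp add: algebra_simps)
          with False show ?thesis unfolding sum_colour by (simp add: mult.assoc)
        qed (simp add: sum_colour m_def mult.assoc)
        finally show ?thesis .
      qed
    qed
    have "(\<Sum>v\<in>pverts t. g v * (if v \<in> K then m else F (card K) f))
      = (\<Sum>v\<in>pverts t. F (card K) f * g v + (if v \<in> K then (m - F (card K) f) * g v else 0))"
      by (intro sum.cong) (auto simp: algebra_simps)
    also have "\<dots> = F (card K) f * D + (m - F (card K) f) * f"
      using K by (simp add: sum.distrib gD gK sum.If_cases Int_absorb1 Int_absorb2 flip: sum_distrib_left)
    finally have total: "(\<Sum>v\<in>pverts t. g v * (if v \<in> K then m else F (card K) f))
      = F (card K) f * D + (m - F (card K) f) * f" .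
    have "(\<Sum>v\<in>pverts t. \<Sum>c\<in>UNIV.
        prob (past_and_child n t s v c) * \<Phi> (add_child t v (Suc n)) (s(Suc n := c)))
      = prob (past n t s) / D * (F (card K) f * D + (m - F (card K) f) * f)"
      unfolding total[symmetric] sum_distrib_left by (intro sum.cong inner refl)
    also have "\<dots> = prob (past n t s) * \<Psi> t s"
      using D unfolding \<Psi>_def mean_after_step_def D_def[symmetric] K_def[symmetric] f_def[symmetric] m_def
      by (simp add: field_simps)
    finally show ?thesis .
  qed
  have "expectation (\<lambda>\<omega>. \<Phi> (T (Suc n) \<omega>) (\<sigma> (Suc n) \<omega>))
    = (\<Sum>(t, s)\<in>pasts n. prob (past n t s) * \<Psi> t s)"
  proof (subst expectation_past_and_child[OF assms(1)])
    show "\<Phi> t s' = \<Phi> t s" if "grown (Suc n) t" "\<And>u. u \<in> pverts t \<Longrightarrow> s' u = s u" for t s s'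
      using cluster_cong[OF that] free_slots_cong[OF that] by (simp add: \<Phi>_def)
    show "(\<Sum>(t, s)\<in>pasts n. \<Sum>v\<in>pverts t. \<Sum>c\<in>UNIV.
        prob (past_and_child n t s v c) * \<Phi> (add_child t v (Suc n)) (s(Suc n := c)))
      = (\<Sum>(t, s)\<in>pasts n. prob (past n t s) * \<Psi> t s)"
      by (intro sum.cong refl) (auto simp: pasts_def step)
  qed
  also have "\<dots> = expectation (\<lambda>\<omega>. \<Psi> (T n \<omega>) (\<sigma> n \<omega>))"
  proof (rule expectation_past[OF assms(1), symmetric])
    show "\<Psi> t s' = \<Psi> t s" if "grown n t" "\<And>u. u \<in> pverts t \<Longrightarrow> s' u = s u" for t s s'
      using cluster_cong[OF that] free_slots_cong[OF that] by (simp add: \<Psi>_def)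
  qed
  finally show ?thesis unfolding \<Phi>_def \<Psi>_def .
qed

end

section \<open>The limit of the cluster size\<close>

text \<open>
  A monotone sequence of natural numbers can leave the value \<open>k\<close> only once.
\<close>

lemma tendsto_of_bool_eq_of_mono:
  fixes c :: "nat \<Rightarrow> nat"
  assumes "mono c"
  shows "(\<lambda>n. of_bool (c n = k) :: real) \<longlonglongrightarrow> of_bool (c \<longlonglongrightarrow> k)"
proof (cases "c \<longlonglongrightarrow> k")
  case True
  then have "\<forall>\<^sub>F n in sequentially. c n = k" by (simp add: tendsto_discrete)
  then show ?thesis using True by (auto intro!: tendsto_eventually elim: eventually_mono)
next
  case False
  have "\<forall>\<^sub>F n in sequentially. c n \<noteq> k"
  proof (cases "\<exists>N. c N > k")
    case True
    then obtain N where "c N > k" by blast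
    then have "c n \<noteq> k" if "n \<ge> N" for n using monoD[OF assms that] by simp
    then show ?thesis by (auto simp: eventually_sequentially)
  next
    case never_above: False
    have "c n \<noteq> k" for n
    proof
      assume "c n = k"
      then have "c n' = k" if "n' \<ge> n" for n'
        using monoD[OF assms that] never_above by (metis le_neq_implies_less)
      then have "c \<longlonglongrightarrow> k"
        by (auto simp: tendsto_discrete eventually_sequentially)
      with False show False ..
    qed
    then show ?thesis by simp
  qed
  then show ?thesis using False by (auto intro!: tendsto_eventually elim: eventually_mono)
qed

context broadcasting_trees
begin

text \<open>
  The index is shifted because the process starts at time \<open>1\<close>.
\<close>

lemma mono_size_at:
  assumes "\<omega> \<in> space M"
  shows "mono (\<lambda>n. size_at (Suc n) \<omega>)"
proof (rule incseq_SucI)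
  fix n
  let ?n = "Suc n"
  have t: "grown ?n (T ?n \<omega>)" using grown_T assms by simp
  obtain v where v: "v \<in> pverts (T ?n \<omega>)" "T (Suc ?n) \<omega> = add_child (T ?n \<omega>) v (Suc ?n)"
    using tree_step[OF _ assms, of ?n] by auto
  have "cluster (T ?n \<omega>) (\<sigma> (Suc ?n) \<omega>) = cluster (T ?n \<omega>) (\<sigma> ?n \<omega>)"
    using colour_kept[OF _ assms, of ?n] by (intro cluster_cong[OF t]) simp
  then show "size_at ?n \<omega> \<le> size_at (Suc ?n) \<omega>"
    unfolding v(2) card_cluster_add_child[OF t v(1)] by simp
qed

lemma integrable_state:
  assumes "n \<ge> 1"
  shows "integrable M (\<lambda>\<omega>. F (size_at n \<omega>) (slots_at n \<omega>) :: real)"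
proof (rule integrable_past[OF assms, of "\<lambda>t s. F (card (cluster t s)) (free_slots d t s)"])
  show "F (card (cluster t s')) (free_slots d t s') = F (card (cluster t s)) (free_slots d t s)"
    if "grown n t" "\<And>u. u \<in> pverts t \<Longrightarrow> s' u = s u" for t s s'
    using cluster_cong[OF that] free_slots_cong[OF that] by simp
qed

text \<open>
  \<open>hit\<close> is harmonic for the walk, so its mean never changes; at time \<open>1\<close> the cluster is the root with
  \<open>d\<close> free slots.
\<close>

lemma expectation_hit:
  assumes "d \<ge> 1"
  shows "expectation (\<lambda>\<omega>. hit d p k (size_at (Suc n) \<omega>) (slots_at (Suc n) \<omega>)) = hit d p k 1 d"
proof (induction n)
  case 0
  have "expectation (\<lambda>\<omega>. hit d p k (size_at 1 \<omega>) (slots_at 1 \<omega>)) = expectation (\<lambda>\<omega>. hit d p k 1 d)"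
    by (intro Bochner_Integration.integral_cong refl)
      (use tree_1 in \<open>simp add: cluster_single_root free_slots_def\<close>)
  then show ?case by (simp add: prob_space)
next
  case (Suc n)
  then show ?case
    using expectation_step[of "Suc n" "hit d p k"] assms by (simp add: mean_hit)
qed

lemma expectation_life_tendsto_0:
  assumes "d \<ge> 1" "0 \<le> p" "p \<le> 1" "k \<ge> 1"
  shows "(\<lambda>n. expectation (\<lambda>\<omega>. real (life d k (size_at n \<omega>) (slots_at n \<omega>)))) \<longlonglongrightarrow> 0"
proof (rule tendsto_zero_of_harmonic_contraction)
  show "0 < 1 / real (k * d * d)" using assms by simp
  show "0 \<le> expectation (\<lambda>\<omega>. real (life d k (size_at n \<omega>) (slots_at n \<omega>)))" for n
    by (intro integral_nonneg_AE) simp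
  fix n :: nat assume n: "n \<ge> 1"
  have "expectation (\<lambda>\<omega>. real (life d k (size_at (Suc n) \<omega>) (slots_at (Suc n) \<omega>)))
    = expectation (\<lambda>\<omega>. mean_after_step d p n (\<lambda>c f. real (life d k c f)) (size_at n \<omega>) (slots_at n \<omega>))"
    by (rule expectation_step[OF n assms(1)])
  also have "\<dots> \<le> expectation (\<lambda>\<omega>. (1 - 1 / real (k * d * d) / real n)
      * real (life d k (size_at n \<omega>) (slots_at n \<omega>)))"
    by (intro integral_mono integrable_state[OF n, of "mean_after_step d p n _"]
        integrable_mult_right integrable_state[OF n, of "\<lambda>c f. real (life d k c f)"]
        mean_life assms n free_slots_le)
  finally show "expectation (\<lambda>\<omega>. real (life d k (size_at (Suc n) \<omega>) (slots_at (Suc n) \<omega>)))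
    \<le> (1 - 1 / real (k * d * d) / real n) * expectation (\<lambda>\<omega>. real (life d k (size_at n \<omega>) (slots_at n \<omega>)))"
    by simp
qed

lemma expectation_size_indicator_tendsto:
  assumes "d \<ge> 1" "0 \<le> p" "p \<le> 1" "k \<ge> 1"
  shows "(\<lambda>n. expectation (\<lambda>\<omega>. of_bool (size_at (Suc n) \<omega> = k))) \<longlonglongrightarrow> hit d p k 1 d"
proof -
  let ?e = "\<lambda>n. expectation (\<lambda>\<omega>. of_bool (size_at (Suc n) \<omega> = k)) :: real"
  let ?l = "\<lambda>n. expectation (\<lambda>\<omega>. real (life d k (size_at (Suc n) \<omega>) (slots_at (Suc n) \<omega>)))"
  have bound: "norm (hit d p k 1 d - ?e n) \<le> ?l n" for n
  proof -
    note int = integrable_state[of "Suc n" "hit d p k"]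
      integrable_state[of "Suc n" "\<lambda>c f. of_bool (c = k)"]
      integrable_state[of "Suc n" "\<lambda>c f. real (life d k c f)"]
    have "\<bar>hit d p k 1 d - ?e n\<bar>
      = \<bar>expectation (\<lambda>\<omega>. hit d p k (size_at (Suc n) \<omega>) (slots_at (Suc n) \<omega>) - of_bool (size_at (Suc n) \<omega> = k))\<bar>"
      using int by (simp add: expectation_hit[OF assms(1)] Bochner_Integration.integral_diff)
    also have "\<dots> \<le> expectation (\<lambda>\<omega>. \<bar>hit d p k (size_at (Suc n) \<omega>) (slots_at (Suc n) \<omega>) - of_bool (size_at (Suc n) \<omega> = k)\<bar>)"
      by (rule integral_abs_bound)
    also have "\<dots> \<le> ?l n"
      using int by (intro integral_mono hit_near_indicator assms integrable_abs Bochner_Integration.integrable_diff) auto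
    finally show ?thesis unfolding real_norm_def .
  qed
  have "?l \<longlonglongrightarrow> 0"
    using LIMSEQ_Suc[OF expectation_life_tendsto_0[OF assms]] .
  then have "(\<lambda>n. hit d p k 1 d - ?e n) \<longlonglongrightarrow> 0"
    by (rule Lim_null_comparison[OF always_eventually[OF allI[OF bound]]])
  then have "(\<lambda>n. hit d p k 1 d - (hit d p k 1 d - ?e n)) \<longlonglongrightarrow> hit d p k 1 d - 0"
    by (intro tendsto_diff tendsto_const)
  then show ?thesis by simp
qed

text \<open>
  Cluster sizes grow along every outcome, so the indicators of size \<open>k\<close> converge pointwise to the
  indicator of the limit being \<open>k\<close>, and dominated convergence turns this into convergence of
  probabilities.
\<close>

lemma prob_size_at_tendsto:
  assumes "d \<ge> 1" "0 \<le> p" "p \<le> 1" "k \<ge> 1"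
  shows "\<P>(\<omega> in M. (\<lambda>n. size_at n \<omega>) \<longlonglongrightarrow> k) = hit d p k 1 d"
proof -
  let ?u = "\<lambda>n \<omega>. of_bool (size_at (Suc n) \<omega> = k) :: real"
  let ?v = "\<lambda>\<omega>. of_bool ((\<lambda>n. size_at (Suc n) \<omega>) \<longlonglongrightarrow> k) :: real"
  have u [measurable]: "?u n \<in> borel_measurable M" for n
    using integrable_state[of "Suc n" "\<lambda>c f. of_bool (c = k)"] by (intro borel_measurable_integrable) auto
  have lim: "(\<lambda>n. ?u n \<omega>) \<longlonglongrightarrow> ?v \<omega>" if "\<omega> \<in> space M" for \<omega>
    using tendsto_of_bool_eq_of_mono[OF mono_size_at[OF that]] .
  have v [measurable]: "?v \<in> borel_measurable M"
    by (rule borel_measurable_LIMSEQ_real[OF lim u])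
  have "(\<lambda>n. expectation (?u n)) \<longlonglongrightarrow> expectation ?v"
    by (rule integral_dominated_convergence[where w = "\<lambda>_. 1"])
      (use lim in \<open>auto intro!: AE_I2 simp del: of_bool_eq_1_iff split del: if_split\<close>)
  then have "expectation ?v = hit d p k 1 d"
    using expectation_size_indicator_tendsto[OF assms] LIMSEQ_unique by blast
  moreover have "expectation ?v = \<P>(\<omega> in M. ?v \<omega> = 1)"
  proof -
    have "expectation ?v = expectation (indicator {\<omega> \<in> space M. ?v \<omega> = 1})"
      by (intro Bochner_Integration.integral_cong) (auto simp: indicator_def)
    also have "\<dots> = prob ({\<omega> \<in> space M. ?v \<omega> = 1} \<inter> space M)"
      by (rule Bochner_Integration.integral_indicator)
    also have "{\<omega> \<in> space M. ?v \<omega> = 1} \<inter> space M = {\<omega> \<in> space M. ?v \<omega> = 1}" by blast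
    finally show ?thesis .
  qed
  moreover have "{\<omega> \<in> space M. ?v \<omega> = 1} = {\<omega> \<in> space M. (\<lambda>n. size_at n \<omega>) \<longlonglongrightarrow> k}"
  proof -
    have "?v \<omega> = 1 \<longleftrightarrow> (\<lambda>n. size_at n \<omega>) \<longlonglongrightarrow> k" for \<omega>
      using filterlim_sequentially_Suc[of "\<lambda>n. size_at n \<omega>" "nhds k"] by simp
    then show ?thesis by simp
  qed
  ultimately show ?thesis by simp
qed

end

theorem corollary2p13:
  fixes M :: "'w measure"
    and d k :: nat and p :: real
    and T :: "nat \<Rightarrow> 'w \<Rightarrow> nat pair_pre_digraph"
    and \<sigma> :: "nat \<Rightarrow> 'w \<Rightarrow> nat \<Rightarrow> colour"
  assumes "d \<ge> 2"
    and "p \<in> {0..1}"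
    and "broadcasting_trees M d p T \<sigma>"
    and "k \<ge> 1"
  shows "\<P>(\<omega> in M. (\<lambda>n. card (verts (root_cluster (T n \<omega>) (\<sigma> n \<omega>)))) \<longlonglongrightarrow> k)
    = 1 / real k * real ((k * d) choose (k - 1)) * p ^ (k - 1) * (1 - p) ^ (k * d - k + 1)"
proof -
  interpret broadcasting_trees M d p T \<sigma> by (rule assms(3))
  have "((\<lambda>n. card (verts (root_cluster (T n \<omega>) (\<sigma> n \<omega>)))) \<longlonglongrightarrow> k)
      \<longleftrightarrow> ((\<lambda>n. size_at n \<omega>) \<longlonglongrightarrow> k)" if "\<omega> \<in> space M" for \<omega>
    using that by (intro tendsto_cong eventually_sequentiallyI[of 1])
      (simp add: verts_root_cluster[OF grown_T])
  then have "\<P>(\<omega> in M. (\<lambda>n. card (verts (root_cluster (T n \<omega>) (\<sigma> n \<omega>)))) \<longlonglongrightarrow> k)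
    = \<P>(\<omega> in M. (\<lambda>n. size_at n \<omega>) \<longlonglongrightarrow> k)"
    by (metis (mono_tags, lifting))
  also have "\<dots> = hit d p k 1 d"
    using assms by (intro prob_size_at_tendsto) auto
  also have "\<dots> = 1 / real k * real ((k * d) choose (k - 1)) * p ^ (k - 1) * (1 - p) ^ (k * d - k + 1)"
    using assms by (intro hit_start) auto
  finally show ?thesis .
qed

end
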